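(* For $n \ge 1$ let \[\mathcal{A}_n = \Big\{ x \in [0,1]^n : \sum_{i\in I} x_i + \sum_{i\notin I}(1-x_i) \ge \tfrac12 \text{ for all } I \subseteq [n]\Big\}.\] Then $\mathcal{A}_n$ has a symmetric extension of size $O(n)$ with respect to the group $\mathbb{Z}_2 \wr S_n$ of symmetries of the cube $[0,1]^n$ (generated by coordinate permutations and the reflections $x_i \mapsto 1-x_i$).
   Context: For a finite group $G$ acting affinely on $\mathbb{R}^m$ and a $G$-invariant polytope $P\subseteq\mathbb{R}^m$, a symmetric extension is a polytope $Q\subseteq\mathbb{R}^d$ invariant under some affine $G$-action on $\mathbb{R}^d$, together with a linear map $p\colon\mathbb{R}^d\to\mathbb{R}^m$ with $p(Q)=P$ and $p(gx)=g\,p(x)$ for all $g\in G$, $x \in Q$. Its size is the number of facets of $Q$. *)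

theory Defs
  imports
    "HOL-Analysis.Analysis"
    "HOL-Analysis.Finite_Function_Topology"
    "HOL-Algebra.Group_Action"
    "HOL-Algebra.Generated_Groups"
    "HOL-Combinatorics.Permutations"
    "HOL-Library.Landau_Symbols"
begin

text \<open>
  The dimension has to be quantified inside formulas, so \<open>\<real>\<^sup>n\<close> is the subspace of the
  finitely supported real sequences whose support lies in \<open>{1..n}\<close>. The library notions
  \<^const>\<open>polytope\<close>, \<^const>\<open>face_of\<close>, \<^const>\<open>linear\<close> and
  \<^const>\<open>dim\<close> are available for this type.
\<close>

type_synonym rvec = "nat \<Rightarrow>\<^sub>0 real"

definition euclid :: "nat \<Rightarrow> rvec set" where
  "euclid n = {x. Poly_Mapping.keys x \<subseteq> {1..n}}"

definition mk_vec :: "nat \<Rightarrow> (nat \<Rightarrow> real) \<Rightarrow> rvec" where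
  "mk_vec n f = (\<Sum>i=1..n. Poly_Mapping.single i (f i))"


text \<open>
  The library's \<^const>\<open>aff_dim\<close> and \<^const>\<open>facet_of\<close> are restricted to class
  \<^class>\<open>euclidean_space\<close>, to which \<^typ>\<open>rvec\<close> does not belong. The following
  versions keep the library's conventions: the empty set has dimension \<open>-1\<close>, and facets are
  nonempty.
\<close>

definition affine_dim :: "'a::real_vector set \<Rightarrow> int" where
  "affine_dim S = (if S = {} then - 1 else int (dim {x - y | x y. x \<in> S \<and> y \<in> S}))"

definition facets :: "'a::real_vector set \<Rightarrow> 'a set set" where
  "facets S = {F. F face_of S \<and> F \<noteq> {} \<and> affine_dim F = affine_dim S - 1}"

definition affine_map_on :: "'a::real_vector set \<Rightarrow> ('a \<Rightarrow> 'b::real_vector) \<Rightarrow> bool" where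
  "affine_map_on S f \<longleftrightarrow>
     (\<forall>x\<in>S. \<forall>y\<in>S. \<forall>u. f ((1 - u) *\<^sub>R x + u *\<^sub>R y) = (1 - u) *\<^sub>R f x + u *\<^sub>R f y)"

definition affine_group_action :: "('g, 'm) monoid_scheme \<Rightarrow> nat \<Rightarrow> ('g \<Rightarrow> rvec \<Rightarrow> rvec) \<Rightarrow> bool" where
  "affine_group_action G m \<phi> \<longleftrightarrow>
     group_action G (euclid m) \<phi> \<and> (\<forall>g\<in>carrier G. affine_map_on (euclid m) (\<phi> g))"

definition invariant_polytope ::
    "('g, 'm) monoid_scheme \<Rightarrow> nat \<Rightarrow> ('g \<Rightarrow> rvec \<Rightarrow> rvec) \<Rightarrow> rvec set \<Rightarrow> bool" where
  "invariant_polytope G m \<phi> P \<longleftrightarrow>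
     affine_group_action G m \<phi> \<and> P \<subseteq> euclid m \<and> polytope P \<and> (\<forall>g\<in>carrier G. \<phi> g ` P = P)"

text \<open>
  The map \<open>p\<close> is a linear map on the whole type that sends \<open>\<real>\<^sup>d\<close> into \<open>\<real>\<^sup>m\<close>; every linear
  map \<open>\<real>\<^sup>d \<rightarrow> \<real>\<^sup>m\<close> is the restriction of such a map.
\<close>

definition symmetric_extension ::
    "('g, 'm) monoid_scheme \<Rightarrow> nat \<Rightarrow> ('g \<Rightarrow> rvec \<Rightarrow> rvec) \<Rightarrow> rvec set \<Rightarrow>
     nat \<Rightarrow> ('g \<Rightarrow> rvec \<Rightarrow> rvec) \<Rightarrow> rvec set \<Rightarrow> (rvec \<Rightarrow> rvec) \<Rightarrow> bool" where
  "symmetric_extension G m \<phi> P d \<rho> Q p \<longleftrightarrow>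
     finite (carrier G) \<and>
     invariant_polytope G m \<phi> P \<and>
     invariant_polytope G d \<rho> Q \<and>
     linear p \<and> p ` euclid d \<subseteq> euclid m \<and>
     p ` Q = P \<and>
     (\<forall>g\<in>carrier G. \<forall>x\<in>Q. p (\<rho> g x) = \<phi> g (p x))"

definition extension_size :: "rvec set \<Rightarrow> nat" where
  "extension_size Q = card (facets Q)"


text \<open>
  The group \<open>\<int>\<^sub>2 \<wr> S\<^sub>n\<close> in its realization as the group of symmetries of the cube: the subgroup
  of the bijections of \<open>\<real>\<^sup>n\<close> generated by coordinate permutations and reflections. Its elements
  are themselves maps on \<open>\<real>\<^sup>n\<close> (extensional, as required by \<^const>\<open>BijGroup\<close>), so its
  natural action is \<open>\<lambda>g. g\<close>.
\<close>

definition coord_perm :: "nat \<Rightarrow> (nat \<Rightarrow> nat) \<Rightarrow> rvec \<Rightarrow> rvec" where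
  "coord_perm n \<pi> = (\<lambda>x\<in>euclid n. mk_vec n (\<lambda>i. Poly_Mapping.lookup x (\<pi> i)))"

definition coord_reflection :: "nat \<Rightarrow> nat \<Rightarrow> rvec \<Rightarrow> rvec" where
  "coord_reflection n j =
     (\<lambda>x\<in>euclid n. mk_vec n (\<lambda>i. if i = j then 1 - Poly_Mapping.lookup x i
                                           else Poly_Mapping.lookup x i))"

definition cube_group :: "nat \<Rightarrow> (rvec \<Rightarrow> rvec) monoid" where
  "cube_group n = subgroup_generated (BijGroup (euclid n))
     ({coord_perm n \<pi> | \<pi>. \<pi> permutes {1..n}} \<union> {coord_reflection n j | j. j \<in> {1..n}})"

definition cropped_cube :: "nat \<Rightarrow> rvec set" where
  "cropped_cube n =
     {x \<in> euclid n.
        (\<forall>i\<in>{1..n}. 0 \<le> Poly_Mapping.lookup x i \<and> Poly_Mapping.lookup x i \<le> 1) \<and>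
        (\<forall>I\<subseteq>{1..n}. (\<Sum>i\<in>I. Poly_Mapping.lookup x i)
                         + (\<Sum>i\<in>{1..n} - I. 1 - Poly_Mapping.lookup x i) \<ge> 1 / 2)}"

end

theory Submission
  imports Defs
begin

text \<open>
  The exponentially many inequalities of the cropped cube say that
  \<open>\<Sum>\<^sub>i min x\<^sub>i (1 - x\<^sub>i) \<ge> 1/2\<close>. Hence it is the projection to \<open>x\<close> of the set of all
  \<open>(x, z)\<close> with \<open>0 \<le> z\<^sub>i \<le> x\<^sub>i \<le> 1 - z\<^sub>i\<close> and \<open>\<Sum>\<^sub>i z\<^sub>i = 1/2\<close>, which is given by \<open>3n\<close>
  inequalities inside an affine space and so has at most \<open>3n\<close> facets. A symmetry of the cube acts
  on \<open>z\<close> through its underlying permutation only, since \<open>x\<^sub>j \<mapsto> 1 - x\<^sub>j\<close> preserves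
  the constraints on \<open>z\<^sub>j\<close>. The vertices of the lifted set are the points with
  \<open>z = e\<^sub>j / 2\<close>, \<open>x\<^sub>j = 1/2\<close> and all other \<open>x\<^sub>i\<close> in \<open>{0, 1}\<close>.
\<close>

section \<open>Facets of sets defined by linear inequalities\<close>

text \<open>A basis \<open>C\<close> of \<open>U\<close> stays independent when \<open>w\<close> is
  added, because \<open>f\<close> vanishes on \<open>span C\<close> but not at \<open>w\<close>;
  extending it to a basis of \<open>W\<close> gives the larger dimension. Finiteness of
  \<open>B\<close> keeps that basis finite, so cardinalities compare strictly.\<close>

lemma dim_less_if_linear_vanishes:
  fixes f :: "'a::real_vector \<Rightarrow> real"
  assumes "U \<subseteq> W" "W \<subseteq> span B" "finite B" "linear f"
    and f0: "\<And>x. x \<in> U \<Longrightarrow> f x = 0" and w: "w \<in> W" "f w \<noteq> 0"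
  shows "dim U < dim W"
proof -
  obtain C where C: "C \<subseteq> U" "independent C" "U \<subseteq> span C" "card C = dim U"
    using basis_exists by blast
  have "w \<notin> span C"
    using linear_eq_0_on_span[OF \<open>linear f\<close>, of C w] C(1) f0 w(2) by blast
  then have ind: "independent (insert w C)"
    by (simp add: C(2) independent_insertI)
  have "insert w C \<subseteq> W"
    using C(1) assms(1) w(1) by blast
  with ind obtain D where D: "insert w C \<subseteq> D" "D \<subseteq> W" "independent D" "W \<subseteq> span D"
    using maximal_independent_subset_extend by blast
  have finD: "finite D"
    using independent_span_bound[OF assms(3) D(3)] D(2) assms(2) by blast
  have "w \<notin> C"
    using \<open>w \<notin> span C\<close> span_base by blast
  then have "card C < card (insert w C)"
    using finD D(1) finite_subset by fastforce
  also have "\<dots> \<le> card D"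
    by (rule card_mono[OF finD D(1)])
  also have "\<dots> = dim W"
    by (rule basis_card_eq_dim[OF D(2,4,3)])
  finally show ?thesis
    using C(4) by simp
qed

text \<open>Equations are kept in the affine set \<open>A\<close>, apart from the inequalities
  indexed by \<open>C\<close>. So they do not enter the facet count, and \<open>A\<close> can be cut
  down to a hyperplane section without changing \<open>C\<close>.\<close>

locale linear_inequalities =
  fixes A :: "'a::real_vector set" and C :: "'c set"
    and f :: "'c \<Rightarrow> 'a \<Rightarrow> real" and b :: "'c \<Rightarrow> real"
  assumes affine_A: "affine A" and finite_C: "finite C"
    and linear_f: "\<And>c. c \<in> C \<Longrightarrow> linear (f c)"
begin

definition solutions :: "'a set" where
  "solutions = {x \<in> A. \<forall>c\<in>C. b c \<le> f c x}"

lemma convex_solutions: "convex solutions"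
proof (rule convexI)
  fix x y and u v :: real
  assume xy: "x \<in> solutions" "y \<in> solutions" and uv: "0 \<le> u" "0 \<le> v" "u + v = 1"
  have "b c \<le> f c (u *\<^sub>R x + v *\<^sub>R y)" if c: "c \<in> C" for c
  proof -
    have "b c = u * b c + v * b c"
      using uv(3) by (simp flip: distrib_right)
    also have "\<dots> \<le> u * f c x + v * f c y"
      using xy c uv(1,2) by (intro add_mono mult_left_mono) (auto simp: solutions_def)
    also have "\<dots> = f c (u *\<^sub>R x + v *\<^sub>R y)"
      by (simp add: linear_add[OF linear_f[OF c]] linear_scale[OF linear_f[OF c]])
    finally show ?thesis .
  qed
  then show "u *\<^sub>R x + v *\<^sub>R y \<in> solutions"
    using mem_affine[OF affine_A] xy uv(3) by (simp add: solutions_def)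
qed

text \<open>If the claim failed, every inequality that is not an equality on all solutions would be
  strict somewhere on \<open>F\<close>. Averaging gives one point of \<open>F\<close> where all of
  these are strict, hence a relatively interior point, and a face through such a point is
  everything.\<close>

lemma proper_face_subset_hyperplane:
  assumes F: "F face_of solutions" "F \<noteq> {}" "F \<noteq> solutions"
  shows "\<exists>c\<in>C. (\<forall>x\<in>F. f c x = b c) \<and> (\<exists>y\<in>solutions. f c y \<noteq> b c)"
proof (rule ccontr)
  assume neg: "\<not> ?thesis"
  define D where "D = {c \<in> C. \<exists>y\<in>solutions. f c y \<noteq> b c}"
  have FQ: "F \<subseteq> solutions" and cF: "convex F"
    using F(1) by (auto simp: face_of_def)
  have "finite D"
    using finite_C by (simp add: D_def)
  have each: "\<exists>x\<in>F. b c < f c x" if "c \<in> D" for c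
  proof (rule ccontr)
    assume "\<not> ?thesis"
    with FQ that have "\<forall>x\<in>F. f c x = b c"
      by (force simp: D_def solutions_def)
    with that neg show False
      by (auto simp: D_def)
  qed
  \<comment> \<open>Induction by midpoints: at the midpoint of two points of \<open>F\<close> an
    inequality is strict as soon as it is strict at one of them.\<close>
  have pos: "\<exists>x\<in>F. \<forall>c\<in>E. b c < f c x" if "finite E" "E \<subseteq> D" for E
    using that
  proof (induction E)
    case empty
    then show ?case
      using F(2) by auto
  next
    case (insert c E)
    then obtain x where x: "x \<in> F" "\<forall>c\<in>E. b c < f c x"
      by auto
    obtain y where y: "y \<in> F" "b c < f c y"
      using each[of c] insert.prems by auto
    let ?m = "(1/2) *\<^sub>R x + (1/2) *\<^sub>R y"
    have "b e < f e ?m" if "e \<in> insert c E" for e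
    proof -
      have "e \<in> C"
        using that insert.prems by (auto simp: D_def)
      then have "b e \<le> f e x" "b e \<le> f e y" "f e ?m = f e x / 2 + f e y / 2"
        using x(1) y(1) FQ linear_f[of e] by (auto simp: solutions_def linear_add linear_scale)
      moreover have "b e < f e x \<or> b e < f e y"
        using that x(2) y(2) by auto
      ultimately show ?thesis
        by linarith
    qed
    moreover have "?m \<in> F"
      using cF x(1) y(1) by (auto intro: convexD)
    ultimately show ?case
      by blast
  qed
  obtain x where x: "x \<in> F" "\<And>c. c \<in> D \<Longrightarrow> b c < f c x"
    using pos[OF \<open>finite D\<close> order_refl] by blast
  \<comment> \<open>From x one can move a little beyond x along any segment ending in x, so x is relatively
    interior and the face is everything.\<close>
  have "y \<in> F" if y: "y \<in> solutions" for y
  proof (cases "y = x")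
    case False
    have "\<forall>\<^sub>F e in at_right 0. b c < f c x + e * (f c x - f c y)" if "c \<in> D" for c
    proof -
      have "((\<lambda>e. f c x + e * (f c x - f c y)) \<longlongrightarrow> f c x + 0 * (f c x - f c y)) (at_right 0)"
        by (intro tendsto_intros)
      then show ?thesis
        using x(2)[OF that] by (auto dest: order_tendstoD)
    qed
    then have "\<forall>\<^sub>F e in at_right 0. \<forall>c\<in>D. b c < f c x + e * (f c x - f c y)"
      using \<open>finite D\<close> by (simp add: eventually_ball_finite)
    then have "\<forall>\<^sub>F e in at_right 0. 0 < e \<and> (\<forall>c\<in>D. b c < f c x + e * (f c x - f c y))"
      by (intro eventually_conj eventually_at_right_less)
    from eventually_happens[OF this]
    obtain e :: real where e: "0 < e" "\<And>c. c \<in> D \<Longrightarrow> b c < f c x + e * (f c x - f c y)"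
      by (auto simp: trivial_limit_at_right_real)
    define w where "w = (1 + e) *\<^sub>R x + (- e) *\<^sub>R y"
    have "w \<in> A"
      unfolding w_def using affine_A x(1) y FQ
      by (intro mem_affine) (auto simp: solutions_def)
    moreover have "b c \<le> f c w" if "c \<in> C" for c
    proof -
      have fw: "f c w = f c x + e * (f c x - f c y)"
        unfolding w_def linear_add[OF linear_f[OF that]] linear_scale[OF linear_f[OF that]]
        by (simp add: algebra_simps)
      show ?thesis
      proof (cases "c \<in> D")
        case True
        then show ?thesis
          using e(2) fw by force
      next
        case False
        then have "f c x = b c" "f c y = b c"
          using that x(1) y FQ by (auto simp: D_def)
        then show ?thesis
          using fw by simp
      qed
    qed
    ultimately have w: "w \<in> solutions"
      by (simp add: solutions_def)
    have "y \<noteq> w"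
    proof
      assume "y = w"
      then have "(1 + e) *\<^sub>R (x - y) = 0"
        by (simp add: w_def algebra_simps)
      with e(1) False show False
        by simp
    qed
    moreover have "x = (1 - 1 / (1 + e)) *\<^sub>R y + (1 / (1 + e)) *\<^sub>R w"
    proof -
      have "1 - 1 / (1 + e) = e / (1 + e)"
        using e(1) by (simp add: field_simps)
      then show ?thesis
        using e(1) by (simp add: w_def scaleR_add_right scaleR_diff_right)
    qed
    ultimately have "x \<in> open_segment y w"
      unfolding in_segment using e(1) by (intro conjI exI[of _ "1 / (1 + e)"]) auto
    then show ?thesis
      using face_ofD[OF F(1)] y w x(1) by blast
  qed (use x in simp)
  then show False
    using F(3) FQ by blast
qed

text \<open>A facet \<open>F\<close> lies in the set \<open>H\<close> where some constraint, not
  tight on all solutions, is tight. If \<open>F\<close> were smaller than \<open>H\<close>, it would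
  be a proper face of \<open>H\<close>, and a second constraint would separate the two. That makes
  two strict drops in dimension, but a facet has codimension one.\<close>

lemma facet_eq_hyperplane:
  assumes "solutions \<subseteq> span B" "finite B" and F: "F \<in> facets solutions"
  obtains c where "c \<in> C" "F = {x \<in> solutions. f c x = b c}"
proof -
  let ?d = "\<lambda>S :: 'a set. {x - y | x y. x \<in> S \<and> y \<in> S}"
  have face: "F face_of solutions" and ne: "F \<noteq> {}"
    and dimF: "affine_dim F = affine_dim solutions - 1"
    using F by (auto simp: facets_def)
  have FQ: "F \<subseteq> solutions"
    using face by (simp add: face_of_def)
  \<comment> \<open>On differences the constant \<open>b c\<close> cancels: \<open>f c\<close>
    vanishes on those of \<open>S\<close>, while \<open>y - s\<close> shows that it does not vanish
    on those of \<open>T\<close>.\<close>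
  have dim_less: "dim (?d S) < dim (?d T)"
    if ST: "S \<subseteq> T" "S \<noteq> {}" "T \<subseteq> solutions" "c \<in> C" "\<And>x. x \<in> S \<Longrightarrow> f c x = b c" "y \<in> T" "f c y \<noteq> b c"
    for S T c y
  proof -
    obtain s where s: "s \<in> S"
      using ST(2) by blast
    show ?thesis
    proof (rule dim_less_if_linear_vanishes)
      show "?d S \<subseteq> ?d T"
        using ST(1) by blast
      show "?d T \<subseteq> span B"
        using ST(3) assms(1) by (auto intro!: span_diff)
      show "y - s \<in> ?d T"
        using ST(1,6) s by blast
      show "f c x = 0" if "x \<in> ?d S" for x
        using linear_diff[OF linear_f[OF \<open>c \<in> C\<close>]] that s \<open>\<And>x. x \<in> S \<Longrightarrow> f c x = b c\<close> \<open>f c y \<noteq> b c\<close> by auto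
      show "f c (y - s) \<noteq> 0"
        using linear_diff[OF linear_f[OF \<open>c \<in> C\<close>]] s \<open>\<And>x. x \<in> S \<Longrightarrow> f c x = b c\<close> \<open>f c y \<noteq> b c\<close> by auto
    qed (use assms(2) linear_f[OF ST(4)] in auto)
  qed
  have dims: "dim (?d solutions) = dim (?d F) + 1"
    using dimF ne FQ by (auto simp: affine_dim_def split: if_splits)
  then have "F \<noteq> solutions"
    by auto
  then obtain c y where c: "c \<in> C" "\<And>x. x \<in> F \<Longrightarrow> f c x = b c" "y \<in> solutions" "f c y \<noteq> b c"
    using proper_face_subset_hyperplane[OF face ne] by blast
  define H where "H = {x \<in> solutions. f c x = b c}"
  have FH: "F \<subseteq> H"
    using c(2) FQ by (auto simp: H_def)
  have "F = H"
  proof (rule ccontr)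
    assume "F \<noteq> H"
    \<comment> \<open>Adding the equation to \<open>A\<close> gives another instance of the locale
      with the same inequalities, whose solution set is \<open>H\<close>.\<close>
    have aff: "affine {x \<in> A. f c x = b c}"
      unfolding affine_def
    proof (intro ballI allI impI)
      fix x y and u v :: real
      assume xy: "x \<in> {x \<in> A. f c x = b c}" "y \<in> {x \<in> A. f c x = b c}" and uv: "u + v = 1"
      have "f c (u *\<^sub>R x + v *\<^sub>R y) = u * f c x + v * f c y"
        by (simp add: linear_add[OF linear_f[OF c(1)]] linear_scale[OF linear_f[OF c(1)]])
      also have "\<dots> = (u + v) * b c"
        using xy by (simp add: distrib_right)
      finally show "u *\<^sub>R x + v *\<^sub>R y \<in> {x \<in> A. f c x = b c}"
        using xy uv mem_affine[OF affine_A] by simp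
    qed
    interpret H: linear_inequalities "{x \<in> A. f c x = b c}" C f b
      by (rule linear_inequalities.intro[OF aff finite_C linear_f])
    have HQ: "H.solutions = H"
      by (auto simp: H.solutions_def H_def solutions_def)
    have "F face_of H"
      using face_of_subset[OF face FH] by (auto simp: H_def)
    then have "\<exists>c'\<in>C. (\<forall>x\<in>F. f c' x = b c') \<and> (\<exists>y'\<in>H. f c' y' \<noteq> b c')"
      using H.proper_face_subset_hyperplane[of F] ne \<open>F \<noteq> H\<close> unfolding HQ by simp
    then obtain c' y' where c': "c' \<in> C" "\<And>x. x \<in> F \<Longrightarrow> f c' x = b c'" "y' \<in> H" "f c' y' \<noteq> b c'"
      by blast
    have "dim (?d F) < dim (?d H)"
      by (rule dim_less[OF FH ne _ c']) (auto simp: H_def)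
    moreover have "dim (?d H) < dim (?d solutions)"
      by (rule dim_less[OF _ _ order_refl c(1) _ c(3,4)]) (use ne FH in \<open>auto simp: H_def\<close>)
    ultimately show False
      using dims by simp
  qed
  then show thesis
    using that c(1) by (simp add: H_def)
qed

lemma card_facets_le:
  assumes "solutions \<subseteq> span B" "finite B"
  shows "card (facets solutions) \<le> card C"
proof -
  have "facets solutions \<subseteq> (\<lambda>c. {x \<in> solutions. f c x = b c}) ` C"
  proof
    fix F
    assume "F \<in> facets solutions"
    then obtain c where "c \<in> C" "F = {x \<in> solutions. f c x = b c}"
      by (rule facet_eq_hyperplane[OF assms])
    then show "F \<in> (\<lambda>c. {x \<in> solutions. f c x = b c}) ` C"
      by (intro image_eqI)
  qed
  then show ?thesis
    by (meson card_image_le card_mono finite_C finite_imageI le_trans)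
qed

end

section \<open>Coordinates\<close>

abbreviation coord :: "rvec \<Rightarrow> nat \<Rightarrow> real" where
  "coord \<equiv> Poly_Mapping.lookup"

lemma coord_scaleR [simp]: "coord (r *\<^sub>R x) i = r * coord x i"
proof -
  have "finite {k. r *\<^sub>R coord x k \<noteq> 0}"
    by (rule finite_subset[OF _ finite_lookup[of x]]) auto
  then show ?thesis
    by (simp add: scaleR_poly_mapping_def)
qed

lemma euclid_iff: "x \<in> euclid n \<longleftrightarrow> (\<forall>i. i \<notin> {1..n} \<longrightarrow> coord x i = 0)"
  by (auto simp: euclid_def in_keys_iff subset_iff)

lemma coord_mk_vec [simp]: "coord (mk_vec n h) i = (if i \<in> {1..n} then h i else 0)"
  by (auto simp: mk_vec_def lookup_sum lookup_single when_def)

lemma mk_vec_in_euclid [simp]: "mk_vec n h \<in> euclid n"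
  by (simp add: euclid_iff)

lemma euclid_eqI:
  assumes "x \<in> euclid n" "y \<in> euclid n" "\<And>i. i \<in> {1..n} \<Longrightarrow> coord x i = coord y i"
  shows "x = y"
proof (rule poly_mapping_eqI)
  fix i
  show "coord x i = coord y i"
    using assms by (cases "i \<in> {1..n}") (simp_all add: euclid_iff)
qed

lemma mk_vec_coord: "x \<in> euclid n \<Longrightarrow> mk_vec n (coord x) = x"
  by (rule euclid_eqI[of _ n]) auto

lemma subspace_euclid: "subspace (euclid n)"
  by (rule subspaceI) (auto simp: euclid_iff lookup_add)

text \<open>Supplies the finite spanning set required for counting facets.\<close>

lemma euclid_subset_span: "euclid n \<subseteq> span ((\<lambda>i. Poly_Mapping.single i 1) ` {1..n})"
proof
  fix x assume "x \<in> euclid n"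
  have "Poly_Mapping.single i r = r *\<^sub>R Poly_Mapping.single i 1" for i :: nat and r :: real
    by (rule poly_mapping_eqI) (simp add: lookup_single when_def)
  then have "mk_vec n (coord x) = (\<Sum>i=1..n. coord x i *\<^sub>R Poly_Mapping.single i 1)"
    unfolding mk_vec_def by (intro sum.cong refl)
  also have "\<dots> \<in> span ((\<lambda>i. Poly_Mapping.single i 1) ` {1..n})"
    by (intro span_sum span_scale span_base) auto
  finally show "x \<in> span ((\<lambda>i. Poly_Mapping.single i 1) ` {1..n})"
    by (simp add: mk_vec_coord \<open>x \<in> euclid n\<close>)
qed

lemma finite_euclid_values:
  assumes "finite D"
  shows "finite {x \<in> euclid n. \<forall>i\<in>{1..n}. coord x i \<in> D}"
proof (rule finite_subset)
  show "{x \<in> euclid n. \<forall>i\<in>{1..n}. coord x i \<in> D} \<subseteq> mk_vec n ` (PiE {1..n} (\<lambda>_. D))"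
  proof
    fix x assume x: "x \<in> {x \<in> euclid n. \<forall>i\<in>{1..n}. coord x i \<in> D}"
    then have "x = mk_vec n (restrict (coord x) {1..n})"
      by (intro euclid_eqI[of _ n]) auto
    then show "x \<in> mk_vec n ` (PiE {1..n} (\<lambda>_. D))"
      using x by (intro image_eqI) auto
  qed
qed (use assms in \<open>auto intro: finite_PiE\<close>)

section \<open>Signed permutations\<close>

text \<open>Normal form for the symmetries of the cube. The reflections come after the permutation,
  so \<open>S\<close> collects output indices; the restriction to \<open>euclid n\<close> gives the
  extensional form that \<open>BijGroup\<close> works with.\<close>

definition signed_perm :: "nat \<Rightarrow> (nat \<Rightarrow> nat) \<Rightarrow> nat set \<Rightarrow> rvec \<Rightarrow> rvec" where
  "signed_perm n \<pi> S =
     (\<lambda>x\<in>euclid n. mk_vec n (\<lambda>i. if i \<in> S then 1 - coord x (\<pi> i) else coord x (\<pi> i)))"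

lemma signed_perm_in_euclid [simp]: "x \<in> euclid n \<Longrightarrow> signed_perm n \<pi> S x \<in> euclid n"
  by (simp add: signed_perm_def)

lemma coord_signed_perm:
  "x \<in> euclid n \<Longrightarrow> i \<in> {1..n} \<Longrightarrow>
     coord (signed_perm n \<pi> S x) i = (if i \<in> S then 1 - coord x (\<pi> i) else coord x (\<pi> i))"
  by (simp add: signed_perm_def)

lemma signed_perm_eqI:
  assumes "\<And>i. i \<in> {1..n} \<Longrightarrow> \<pi> i = \<sigma> i" "\<And>i. i \<in> {1..n} \<Longrightarrow> i \<in> S \<longleftrightarrow> i \<in> T"
  shows "signed_perm n \<pi> S = signed_perm n \<sigma> T"
  unfolding signed_perm_def
  by (intro restrict_ext euclid_eqI[of _ n]) (use assms in auto)

lemma signed_perm_id: "signed_perm n id {} = (\<lambda>x\<in>euclid n. x)"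
  unfolding signed_perm_def by (intro restrict_ext euclid_eqI[of _ n]) auto

lemma coord_perm_eq: "coord_perm n \<pi> = signed_perm n \<pi> {}"
  by (simp add: coord_perm_def signed_perm_def)

lemma coord_reflection_eq: "coord_reflection n j = signed_perm n id {j}"
  by (simp add: coord_reflection_def signed_perm_def cong: if_cong)

text \<open>Coordinate \<open>i\<close> of the composite reads coordinate \<open>\<pi> i\<close> of
  the inner map's value, hence coordinate \<open>\<sigma> (\<pi> i)\<close> of the argument, so
  permutations compose in reverse order. It is reflected if \<open>i \<in> S\<close> and again if
  \<open>\<pi> i \<in> T\<close>, and two reflections cancel.\<close>

lemma compose_signed_perm:
  assumes "\<pi> permutes {1..n}"
  shows "compose (euclid n) (signed_perm n \<pi> S) (signed_perm n \<sigma> T) =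
         signed_perm n (\<sigma> \<circ> \<pi>) {i \<in> {1..n}. (i \<in> S) \<noteq> (\<pi> i \<in> T)}"
proof (rule extensionalityI[of _ "euclid n"])
  fix x assume x: "x \<in> euclid n"
  have "\<pi> i \<in> {1..n}" if "i \<in> {1..n}" for i
    using permutes_in_image[OF assms] that by blast
  then show "compose (euclid n) (signed_perm n \<pi> S) (signed_perm n \<sigma> T) x =
        signed_perm n (\<sigma> \<circ> \<pi>) {i \<in> {1..n}. (i \<in> S) \<noteq> (\<pi> i \<in> T)} x"
    by (intro euclid_eqI[of _ n]) (use x in \<open>auto simp: compose_def coord_signed_perm\<close>)
qed (auto simp: compose_def signed_perm_def)

text \<open>In the composition law the reflections in \<open>S\<close> cancel against those of the
  inverse once \<open>S\<close> is moved along \<pi>.\<close>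

lemma signed_perm_inverse:
  assumes "\<pi> permutes {1..n}"
  shows "compose (euclid n) (signed_perm n (inv_into UNIV \<pi>) {i \<in> {1..n}. inv_into UNIV \<pi> i \<in> S}) (signed_perm n \<pi> S)
           = (\<lambda>x\<in>euclid n. x)"
    and "compose (euclid n) (signed_perm n \<pi> S) (signed_perm n (inv_into UNIV \<pi>) {i \<in> {1..n}. inv_into UNIV \<pi> i \<in> S})
           = (\<lambda>x\<in>euclid n. x)"
proof -
  have "\<pi> i \<in> {1..n} \<longleftrightarrow> i \<in> {1..n}" for i
    using permutes_in_image[OF assms] .
  then show "compose (euclid n) (signed_perm n \<pi> S) (signed_perm n (inv_into UNIV \<pi>) {i \<in> {1..n}. inv_into UNIV \<pi> i \<in> S})
           = (\<lambda>x\<in>euclid n. x)"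
    unfolding compose_signed_perm[OF assms] signed_perm_id[symmetric]
    by (intro signed_perm_eqI) (auto simp add: permutes_inverses[OF assms])
  show "compose (euclid n) (signed_perm n (inv_into UNIV \<pi>) {i \<in> {1..n}. inv_into UNIV \<pi> i \<in> S}) (signed_perm n \<pi> S)
           = (\<lambda>x\<in>euclid n. x)"
    unfolding compose_signed_perm[OF permutes_inv[OF assms]] signed_perm_id[symmetric]
    by (intro signed_perm_eqI) (simp_all add: permutes_inverses[OF assms])
qed

lemma signed_perm_Bij:
  assumes "\<pi> permutes {1..n}"
  shows "signed_perm n \<pi> S \<in> Bij (euclid n)"
proof -
  have "bij_betw (signed_perm n \<pi> S) (euclid n) (euclid n)"
  proof (rule bij_betw_byWitness)
    let ?g = "signed_perm n (inv_into UNIV \<pi>) {i \<in> {1..n}. inv_into UNIV \<pi> i \<in> S}"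
    show "\<forall>x\<in>euclid n. ?g (signed_perm n \<pi> S x) = x"
    proof
      fix x assume "x \<in> euclid n"
      then show "?g (signed_perm n \<pi> S x) = x"
        using fun_cong[OF signed_perm_inverse(1)[OF assms, of S], of x] by (simp add: compose_eq)
    qed
    show "\<forall>x\<in>euclid n. signed_perm n \<pi> S (?g x) = x"
    proof
      fix x assume "x \<in> euclid n"
      then show "signed_perm n \<pi> S (?g x) = x"
        using fun_cong[OF signed_perm_inverse(2)[OF assms, of S], of x] by (simp add: compose_eq)
    qed
  qed auto
  then show ?thesis
    by (simp add: Bij_def signed_perm_def)
qed

text \<open>The image of 0 reveals \<open>S\<close>, and the images of unit vectors reveal the
  permutation. This makes lifting an element of the cube group well defined.\<close>

lemma signed_perm_inject:
  assumes eq: "signed_perm n \<pi> S = signed_perm n \<sigma> T"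
    and "\<pi> permutes {1..n}" "\<sigma> permutes {1..n}" "S \<subseteq> {1..n}" "T \<subseteq> {1..n}"
  shows "\<pi> = \<sigma> \<and> S = T"
proof
  have S: "i \<in> S \<longleftrightarrow> i \<in> T" if "i \<in> {1..n}" for i
  proof -
    have "coord (signed_perm n \<pi> S 0) i = coord (signed_perm n \<sigma> T 0) i"
      by (simp add: eq)
    then show ?thesis
      using that by (auto simp: coord_signed_perm subspace_0[OF subspace_euclid] split: if_splits)
  qed
  then show "S = T"
    using assms(4,5) by blast
  show "\<pi> = \<sigma>"
  proof
    fix i
    show "\<pi> i = \<sigma> i"
    proof (cases "i \<in> {1..n}")
      case True
      let ?e = "Poly_Mapping.single (\<pi> i) 1 :: rvec"
      have "\<pi> i \<in> {1..n}"
        using True permutes_in_image[OF assms(2)] by blast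
      then have e: "?e \<in> euclid n"
        by (auto simp: euclid_iff lookup_single when_def)
      have "coord (signed_perm n \<pi> S ?e) i = coord (signed_perm n \<sigma> T ?e) i"
        by (simp add: eq)
      then have "coord ?e (\<pi> i) = coord ?e (\<sigma> i)"
        using S[OF True] by (simp add: coord_signed_perm[OF e True] split: if_splits)
      then show ?thesis
        by (auto simp: lookup_single when_def split: if_splits)
    next
      case False
      then show ?thesis
        using assms(2,3) by (simp add: permutes_not_in)
    qed
  qed
qed

text \<open>A reflection respects affine combinations because the weights \<open>1 - u\<close> and
  \<open>u\<close> add up to 1.\<close>

lemma affine_map_on_signed_perm: "affine_map_on (euclid n) (signed_perm n \<pi> S)"
  unfolding affine_map_on_def
proof (intro ballI allI)
  fix x y and u :: real
  assume "x \<in> euclid n" "y \<in> euclid n"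
  moreover from this have "(1 - u) *\<^sub>R x + u *\<^sub>R y \<in> euclid n"
    "(1 - u) *\<^sub>R signed_perm n \<pi> S x + u *\<^sub>R signed_perm n \<pi> S y \<in> euclid n"
    using subspace_euclid by (simp_all add: subspace_add subspace_scale)
  ultimately show "signed_perm n \<pi> S ((1 - u) *\<^sub>R x + u *\<^sub>R y)
      = (1 - u) *\<^sub>R signed_perm n \<pi> S x + u *\<^sub>R signed_perm n \<pi> S y"
    by (intro euclid_eqI[of _ n]) (auto simp: coord_signed_perm lookup_add, auto simp: algebra_simps)
qed

text \<open>Closure follows from the formulas for composites and inverses. Since all generators are
  signed permutations, this subgroup contains the cube group, so every element of the latter has the
  normal form.\<close>

lemma subgroup_signed_perms:
  "subgroup {signed_perm n \<pi> S | \<pi> S. \<pi> permutes {1..n} \<and> S \<subseteq> {1..n}} (BijGroup (euclid n))"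
  (is "subgroup ?H ?G")
proof -
  interpret group ?G
    by (rule group_BijGroup)
  show ?thesis
  proof (rule subgroupI)
    show "?H \<subseteq> carrier ?G"
      by (auto simp: BijGroup_def signed_perm_Bij)
    show "?H \<noteq> {}"
      using permutes_id[of "{1..n}"] by blast
  next
    fix g assume "g \<in> ?H"
    then obtain \<pi> S where g: "g = signed_perm n \<pi> S" "\<pi> permutes {1..n}" "S \<subseteq> {1..n}"
      by blast
    have "inv\<^bsub>?G\<^esub> g = signed_perm n (inv_into UNIV \<pi>) {i \<in> {1..n}. inv_into UNIV \<pi> i \<in> S}"
      by (rule inv_equality)
        (use g permutes_inv[OF g(2)] signed_perm_inverse(1)[OF g(2), of S] in
          \<open>simp_all add: BijGroup_def signed_perm_Bij\<close>)
    then show "inv\<^bsub>?G\<^esub> g \<in> ?H"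
      using permutes_inv[OF g(2)] by blast
  next
    fix g h assume "g \<in> ?H" "h \<in> ?H"
    then obtain \<pi> S \<sigma> T where gh: "g = signed_perm n \<pi> S" "\<pi> permutes {1..n}"
        "h = signed_perm n \<sigma> T" "\<sigma> permutes {1..n}"
      by blast
    then have "g \<otimes>\<^bsub>?G\<^esub> h = signed_perm n (\<sigma> \<circ> \<pi>) {i \<in> {1..n}. (i \<in> S) \<noteq> (\<pi> i \<in> T)}"
      by (simp add: BijGroup_def signed_perm_Bij compose_signed_perm)
    then show "g \<otimes>\<^bsub>?G\<^esub> h \<in> ?H"
      using permutes_compose[OF gh(2,4)] by blast
  qed
qed

section \<open>The cube group and its natural action\<close>

lemma cube_group_elem:
  assumes "g \<in> carrier (cube_group n)"
  obtains \<pi> S where "g = signed_perm n \<pi> S" "\<pi> permutes {1..n}" "S \<subseteq> {1..n}"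
proof -
  have "signed_perm n id {j} \<in> {signed_perm n \<pi> S | \<pi> S. \<pi> permutes {1..n} \<and> S \<subseteq> {1..n}}"
    if "j \<in> {1..n}" for j
    using that permutes_id[of "{1..n}"] by blast
  then have "carrier (cube_group n) \<subseteq> {signed_perm n \<pi> S | \<pi> S. \<pi> permutes {1..n} \<and> S \<subseteq> {1..n}}"
    unfolding cube_group_def coord_perm_eq coord_reflection_eq
    by (intro group.subgroup_generated_minimal[OF group_BijGroup subgroup_signed_perms]) blast
  with assms that show thesis
    by blast
qed

lemma finite_cube_group: "finite (carrier (cube_group n))"
proof (rule finite_subset)
  show "carrier (cube_group n) \<subseteq>
      (\<lambda>(\<pi>, S). signed_perm n \<pi> S) ` ({\<pi>. \<pi> permutes {1..n}} \<times> Pow {1..n})"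
    by (auto elim!: cube_group_elem)
qed (simp add: finite_permutations)

lemma group_cube_group: "group (cube_group n)"
  unfolding cube_group_def by (rule group.group_subgroup_generated[OF group_BijGroup])

text \<open>The group consists of maps and its product is composition, so the inclusion into
  \<open>BijGroup\<close> is the required homomorphism.\<close>

lemma affine_group_action_cube: "affine_group_action (cube_group n) n (\<lambda>g. g)"
proof -
  have "(\<lambda>g. g) \<in> hom (cube_group n) (BijGroup (euclid n))"
  proof (rule homI)
    fix g assume "g \<in> carrier (cube_group n)"
    then show "g \<in> carrier (BijGroup (euclid n))"
      by (auto simp: BijGroup_def signed_perm_Bij elim!: cube_group_elem)
  qed (simp add: cube_group_def)
  then show ?thesis
    unfolding affine_group_action_def group_action_def
    by (auto simp: group_hom_def group_hom_axioms_def group_cube_group group_BijGroup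
      affine_map_on_signed_perm elim!: cube_group_elem)
qed

section \<open>The lifted action on the doubled space\<close>

definition double_perm :: "nat \<Rightarrow> (nat \<Rightarrow> nat) \<Rightarrow> nat \<Rightarrow> nat" where
  "double_perm n \<pi> i = (if i \<le> n then \<pi> i else n + \<pi> (i - n))"

text \<open>The blocks \<open>{1..n}\<close> and \<open>{n+1..2*n}\<close> are permuted in parallel.
  This commutes with composition because \<pi> respects the case split: it keeps indices at most
  \<open>n\<close> in the first case, and it keeps \<open>i - n\<close> positive, so that
  \<open>n + \<pi> (i - n)\<close> stays in the second.\<close>

lemma double_perm_comp:
  assumes "\<pi> permutes {1..n}"
  shows "double_perm n \<sigma> \<circ> double_perm n \<pi> = double_perm n (\<sigma> \<circ> \<pi>)"
proof
  fix i
  have le: "\<pi> j \<le> n" if "j \<le> n" for j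
  proof (cases "j \<in> {1..n}")
    case True
    then have "\<pi> j \<in> {1..n}"
      by (simp only: permutes_in_image[OF assms])
    then show ?thesis
      by simp
  next
    case False
    then have "\<pi> j = j"
      by (rule permutes_not_in[OF assms])
    then show ?thesis
      using that by simp
  qed
  have pos: "0 < \<pi> j" if "0 < j" for j
  proof (rule ccontr)
    assume "\<not> 0 < \<pi> j"
    then have "\<pi> j = 0"
      by simp
    also have "0 = \<pi> 0"
      by (rule permutes_not_in[OF assms, symmetric]) simp
    finally have "j = 0"
      by (rule injD[OF permutes_inj[OF assms]])
    with that show False
      by simp
  qed
  show "(double_perm n \<sigma> \<circ> double_perm n \<pi>) i = double_perm n (\<sigma> \<circ> \<pi>) i"
  proof (cases "i \<le> n")
    case True
    with le[OF True] show ?thesis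
      by (simp add: double_perm_def)
  next
    case False
    with pos[of "i - n"] show ?thesis
      by (simp add: double_perm_def)
  qed
qed

lemma double_perm_permutes:
  assumes "\<pi> permutes {1..n}"
  shows "double_perm n \<pi> permutes {1..2 * n}"
proof -
  have id: "double_perm n id = id"
    by (auto simp: double_perm_def)
  have "bij (double_perm n \<pi>)"
  proof (rule o_bij)
    show "double_perm n (inv_into UNIV \<pi>) \<circ> double_perm n \<pi> = id"
      by (simp add: double_perm_comp[OF assms] permutes_inv_o[OF assms] id)
    show "double_perm n \<pi> \<circ> double_perm n (inv_into UNIV \<pi>) = id"
      by (simp add: double_perm_comp[OF permutes_inv[OF assms]] permutes_inv_o[OF assms] id)
  qed
  moreover have "double_perm n \<pi> i = i" if "i \<notin> {1..2 * n}" for i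
  proof (cases "i \<le> n")
    case False
    with that have "i - n \<notin> {1..n}"
      by auto
    then have "\<pi> (i - n) = i - n"
      by (rule permutes_not_in[OF assms])
    with False show ?thesis
      by (simp add: double_perm_def)
  next
    case True
    with that have "i \<notin> {1..n}"
      by auto
    then have "\<pi> i = i"
      by (rule permutes_not_in[OF assms])
    with True show ?thesis
      by (simp add: double_perm_def)
  qed
  ultimately show ?thesis
    unfolding permutes_def bij_iff by blast
qed

text \<open>Reflections happen in the first block only, and the second block is never mapped into
  the first, so the reflection set is that of the composition law in dimension
  \<open>n\<close>.\<close>

lemma compose_double_signed_perm:
  assumes "\<pi> permutes {1..n}" "S \<subseteq> {1..n}" "T \<subseteq> {1..n}"
  shows "compose (euclid (2 * n)) (signed_perm (2 * n) (double_perm n \<pi>) S)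
           (signed_perm (2 * n) (double_perm n \<sigma>) T) =
         signed_perm (2 * n) (double_perm n (\<sigma> \<circ> \<pi>)) {i \<in> {1..n}. (i \<in> S) \<noteq> (\<pi> i \<in> T)}"
proof -
  have "double_perm n \<pi> i \<in> T \<longleftrightarrow> i \<le> n \<and> \<pi> i \<in> T" if "i \<in> {1..2 * n}" for i
  proof (cases "i \<le> n")
    case False
    then have "\<pi> (i - n) \<in> {1..n}"
      using that permutes_in_image[OF assms(1), of "i - n"] by auto
    then show ?thesis
      using False assms(3) by (auto simp: double_perm_def)
  qed (simp add: double_perm_def)
  then show ?thesis
    unfolding compose_signed_perm[OF double_perm_permutes[OF assms(1)]] double_perm_comp[OF assms(1)]
    by (intro signed_perm_eqI) (use assms(2) in auto)
qed

text \<open>Group elements are maps, so the permutation and the reflection set have to be read off;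
  they are unique by \<open>signed_perm_inject\<close>. The lift permutes both blocks but reflects
  only in the first.\<close>

definition cube_lift :: "nat \<Rightarrow> (rvec \<Rightarrow> rvec) \<Rightarrow> rvec \<Rightarrow> rvec" where
  "cube_lift n g = (THE h. \<exists>\<pi> S. \<pi> permutes {1..n} \<and> S \<subseteq> {1..n} \<and> g = signed_perm n \<pi> S \<and>
                                h = signed_perm (2 * n) (double_perm n \<pi>) S)"

lemma cube_lift_signed_perm:
  assumes "\<pi> permutes {1..n}" "S \<subseteq> {1..n}"
  shows "cube_lift n (signed_perm n \<pi> S) = signed_perm (2 * n) (double_perm n \<pi>) S"
  unfolding cube_lift_def
proof (rule the_equality)
  fix h
  assume "\<exists>\<sigma> T. \<sigma> permutes {1..n} \<and> T \<subseteq> {1..n} \<and> signed_perm n \<pi> S = signed_perm n \<sigma> T \<and>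
            h = signed_perm (2 * n) (double_perm n \<sigma>) T"
  then obtain \<sigma> T where st: "\<sigma> permutes {1..n}" "T \<subseteq> {1..n}" "signed_perm n \<pi> S = signed_perm n \<sigma> T"
    and h: "h = signed_perm (2 * n) (double_perm n \<sigma>) T"
    by (elim exE conjE)
  have "\<pi> = \<sigma> \<and> S = T"
    by (rule signed_perm_inject[OF st(3) assms(1) st(1) assms(2) st(2)])
  then show "h = signed_perm (2 * n) (double_perm n \<pi>) S"
    using h by simp
next
  show "\<exists>\<sigma> T. \<sigma> permutes {1..n} \<and> T \<subseteq> {1..n} \<and> signed_perm n \<pi> S = signed_perm n \<sigma> T \<and>
          signed_perm (2 * n) (double_perm n \<pi>) S = signed_perm (2 * n) (double_perm n \<sigma>) T"
    using assms by (intro exI[of _ \<pi>] exI[of _ S]) simp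
qed

text \<open>Composites in dimensions \<open>n\<close> and \<open>2 * n\<close> come from the same
  permutation of \<open>{1..n}\<close> and the same reflection set, so the lift is
  multiplicative.\<close>

lemma affine_group_action_cube_lift: "affine_group_action (cube_group n) (2 * n) (cube_lift n)"
proof -
  have "cube_lift n \<in> hom (cube_group n) (BijGroup (euclid (2 * n)))"
  proof (rule homI)
    fix g assume "g \<in> carrier (cube_group n)"
    then show "cube_lift n g \<in> carrier (BijGroup (euclid (2 * n)))"
      by (auto simp: BijGroup_def cube_lift_signed_perm elim!: cube_group_elem
        intro!: signed_perm_Bij[OF double_perm_permutes])
  next
    fix g h assume gh: "g \<in> carrier (cube_group n)" "h \<in> carrier (cube_group n)"
    obtain \<pi> S where g: "g = signed_perm n \<pi> S" "\<pi> permutes {1..n}" "S \<subseteq> {1..n}"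
      using gh(1) by (rule cube_group_elem)
    obtain \<sigma> T where h: "h = signed_perm n \<sigma> T" "\<sigma> permutes {1..n}" "T \<subseteq> {1..n}"
      using gh(2) by (rule cube_group_elem)
    have "g \<otimes>\<^bsub>cube_group n\<^esub> h = signed_perm n (\<sigma> \<circ> \<pi>) {i \<in> {1..n}. (i \<in> S) \<noteq> (\<pi> i \<in> T)}"
      using g h by (simp add: cube_group_def BijGroup_def signed_perm_Bij compose_signed_perm)
    then have "cube_lift n (g \<otimes>\<^bsub>cube_group n\<^esub> h) =
        signed_perm (2 * n) (double_perm n (\<sigma> \<circ> \<pi>)) {i \<in> {1..n}. (i \<in> S) \<noteq> (\<pi> i \<in> T)}"
      by (simp only:) (rule cube_lift_signed_perm[OF permutes_compose[OF g(2) h(2)]], blast)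
    also have "\<dots> = cube_lift n g \<otimes>\<^bsub>BijGroup (euclid (2 * n))\<^esub> cube_lift n h"
      unfolding g(1) h(1) cube_lift_signed_perm[OF g(2,3)] cube_lift_signed_perm[OF h(2,3)]
        compose_double_signed_perm[OF g(2,3) h(3), symmetric]
      by (simp add: BijGroup_def signed_perm_Bij[OF double_perm_permutes[OF g(2)]]
          signed_perm_Bij[OF double_perm_permutes[OF h(2)]])
    finally show "cube_lift n (g \<otimes>\<^bsub>cube_group n\<^esub> h) =
        cube_lift n g \<otimes>\<^bsub>BijGroup (euclid (2 * n))\<^esub> cube_lift n h" .
  qed
  then show ?thesis
    unfolding affine_group_action_def group_action_def
    by (auto simp: group_hom_def group_hom_axioms_def group_cube_group group_BijGroup
      affine_map_on_signed_perm cube_lift_signed_perm elim!: cube_group_elem)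
qed

section \<open>The lifted polytope\<close>

text \<open>A pair (x, z) is stored as one vector, with x_i at index \<open>i\<close> and z_i at
  index \<open>n + i\<close>.\<close>

definition lifted_cube :: "nat \<Rightarrow> rvec set" where
  "lifted_cube n =
     {x \<in> euclid (2 * n).
        (\<forall>i\<in>{1..n}. 0 \<le> coord x (n + i) \<and> coord x (n + i) \<le> coord x i \<and>
                    coord x (n + i) \<le> 1 - coord x i) \<and>
        (\<Sum>i=1..n. coord x (n + i)) = 1 / 2}"

text \<open>A reflection at \<open>i\<close> exchanges the two upper bounds x_i and 1 - x_i of z_i,
  and a permutation only reindexes the bounds and the sum.\<close>

lemma signed_perm_lifted_cube:
  assumes "\<pi> permutes {1..n}" "S \<subseteq> {1..n}" "x \<in> lifted_cube n"
  shows "signed_perm (2 * n) (double_perm n \<pi>) S x \<in> lifted_cube n"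
proof -
  let ?y = "signed_perm (2 * n) (double_perm n \<pi>) S x"
  have x: "x \<in> euclid (2 * n)"
    using assms(3) by (simp add: lifted_cube_def)
  have lo: "coord ?y i = (if i \<in> S then 1 - coord x (\<pi> i) else coord x (\<pi> i))"
    and hi: "coord ?y (n + i) = coord x (n + \<pi> i)" if "i \<in> {1..n}" for i
    using that assms(2) by (auto simp: coord_signed_perm[OF x] double_perm_def)
  have "(\<Sum>i=1..n. coord ?y (n + i)) = (\<Sum>i=1..n. coord x (n + \<pi> i))"
    by (rule sum.cong) (auto simp: hi)
  also have "\<dots> = (\<Sum>i=1..n. coord x (n + i))"
    by (rule sum.reindex_bij_betw[OF permutes_imp_bij[OF assms(1)]])
  finally have "(\<Sum>i=1..n. coord ?y (n + i)) = 1 / 2"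
    using assms(3) by (simp add: lifted_cube_def)
  moreover have "0 \<le> coord ?y (n + i) \<and> coord ?y (n + i) \<le> coord ?y i \<and> coord ?y (n + i) \<le> 1 - coord ?y i"
    if i: "i \<in> {1..n}" for i
  proof -
    have "\<pi> i \<in> {1..n}"
      using i permutes_in_image[OF assms(1)] by blast
    then show ?thesis
      using assms(3) unfolding lo[OF i] hi[OF i] by (auto simp: lifted_cube_def)
  qed
  ultimately show ?thesis
    using x by (simp add: lifted_cube_def)
qed

text \<open>One inclusion is known for every group element; applied to the inverse element it yields
  the other.\<close>

lemma cube_lift_image_lifted_cube:
  assumes "g \<in> carrier (cube_group n)"
  shows "cube_lift n g ` lifted_cube n = lifted_cube n"
proof
  have sub: "cube_lift n h ` lifted_cube n \<subseteq> lifted_cube n" if "h \<in> carrier (cube_group n)" for h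
    using that by (auto elim!: cube_group_elem simp: cube_lift_signed_perm signed_perm_lifted_cube)
  show "cube_lift n g ` lifted_cube n \<subseteq> lifted_cube n"
    by (rule sub[OF assms])
  interpret group_action "cube_group n" "euclid (2 * n)" "cube_lift n"
    using affine_group_action_cube_lift by (simp add: affine_group_action_def)
  let ?h = "inv\<^bsub>cube_group n\<^esub> g"
  have h: "?h \<in> carrier (cube_group n)"
    using assms group.inv_closed[OF group_cube_group] by blast
  show "lifted_cube n \<subseteq> cube_lift n g ` lifted_cube n"
  proof
    fix x assume x: "x \<in> lifted_cube n"
    then have "x \<in> euclid (2 * n)"
      by (simp add: lifted_cube_def)
    then have "cube_lift n g (cube_lift n ?h x) = cube_lift n (g \<otimes>\<^bsub>cube_group n\<^esub> ?h) x"
      by (rule composition_rule[OF _ assms h, symmetric])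
    also have "\<dots> = x"
      using \<open>x \<in> euclid (2 * n)\<close> by (simp add: group.r_inv[OF group_cube_group assms] flip: id_eq_one)
    finally have "cube_lift n g (cube_lift n ?h x) = x" .
    moreover have "cube_lift n ?h x \<in> lifted_cube n"
      using sub[OF h] x by blast
    ultimately show "x \<in> cube_lift n g ` lifted_cube n"
      by (intro image_eqI) auto
  qed
qed

section \<open>Counting the facets of the lifted polytope\<close>

definition lifted_cube_form :: "nat \<Rightarrow> nat \<times> nat \<Rightarrow> rvec \<Rightarrow> real" where
  "lifted_cube_form n = (\<lambda>(i, k) x. if k = 0 then coord x (n + i)
     else if k = 1 then coord x i - coord x (n + i) else - coord x i - coord x (n + i))"

text \<open>All constraints are lower bounds on linear forms; the bound -1 comes from rewriting x_i
  + z_i \<le> 1 as - x_i - z_i \<ge> -1.\<close>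

definition lifted_cube_bound :: "nat \<times> nat \<Rightarrow> real" where
  "lifted_cube_bound = (\<lambda>(i, k). if k = 2 then - 1 else 0)"

text \<open>The equation for the sum of z belongs to the affine set, so exactly \<open>3 * n\<close>
  inequalities are counted.\<close>

interpretation lifted_cube: linear_inequalities
  "{x \<in> euclid (2 * n). (\<Sum>i=1..n. coord x (n + i)) = 1 / 2}" "{1..n} \<times> {0, 1, 2}"
  "lifted_cube_form n" lifted_cube_bound
  for n
proof (rule linear_inequalities.intro)
  have "u *\<^sub>R x + v *\<^sub>R y \<in> euclid (2 * n) \<and> (\<Sum>i=1..n. coord (u *\<^sub>R x + v *\<^sub>R y) (n + i)) = 1 / 2"
    if "x \<in> euclid (2 * n)" "(\<Sum>i=1..n. coord x (n + i)) = 1 / 2"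
      "y \<in> euclid (2 * n)" "(\<Sum>i=1..n. coord y (n + i)) = 1 / 2" "u + v = 1" for x y u v
  proof
    show "u *\<^sub>R x + v *\<^sub>R y \<in> euclid (2 * n)"
      using that(1,3) subspace_euclid by (simp add: subspace_add subspace_scale)
    have "(\<Sum>i=1..n. coord (u *\<^sub>R x + v *\<^sub>R y) (n + i))
        = u * (\<Sum>i=1..n. coord x (n + i)) + v * (\<Sum>i=1..n. coord y (n + i))"
      by (simp add: lookup_add sum.distrib sum_distrib_left)
    also have "\<dots> = (u + v) / 2"
      unfolding that(2,4) by simp
    finally show "(\<Sum>i=1..n. coord (u *\<^sub>R x + v *\<^sub>R y) (n + i)) = 1 / 2"
      using that(5) by simp
  qed
  then show "affine {x \<in> euclid (2 * n). (\<Sum>i=1..n. coord x (n + i)) = 1 / 2}"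
    unfolding affine_def by blast
  show "linear (lifted_cube_form n c)" for c
    by (cases c, rule linearI) (simp_all add: lifted_cube_form_def lookup_add algebra_simps)
qed simp

lemma lifted_cube_eq_solutions: "lifted_cube n = lifted_cube.solutions n"
proof -
  have "(\<forall>c\<in>{1..n} \<times> {0, 1, 2}. lifted_cube_bound c \<le> lifted_cube_form n c x) \<longleftrightarrow>
      (\<forall>i\<in>{1..n}. 0 \<le> coord x (n + i) \<and> coord x (n + i) \<le> coord x i \<and>
                    coord x (n + i) \<le> 1 - coord x i)" for x
    by (auto simp: lifted_cube_form_def lifted_cube_bound_def)
  then show ?thesis
    unfolding lifted_cube.solutions_def lifted_cube_def by blast
qed

lemma extension_size_lifted_cube: "extension_size (lifted_cube n) \<le> 3 * n"
proof -
  have "lifted_cube.solutions n \<subseteq> span ((\<lambda>i. Poly_Mapping.single i 1) ` {1..2 * n})"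
    using euclid_subset_span[of "2 * n"] unfolding lifted_cube.solutions_def by blast
  then have "card (facets (lifted_cube.solutions n)) \<le> card ({1..n} \<times> {0, 1, 2::nat})"
    by (rule lifted_cube.card_facets_le) simp
  then show ?thesis
    by (simp add: extension_size_def lifted_cube_eq_solutions card_cartesian_product)
qed

section \<open>The lifted polytope as a convex hull of finitely many points\<close>

definition lifted_cube_vertices :: "nat \<Rightarrow> rvec set" where
  "lifted_cube_vertices n = {x \<in> lifted_cube n. \<forall>i\<in>{1..2 * n}. coord x i \<in> {0, 1 / 2, 1}}"

text \<open>All coordinates come from a three-element set. Points that are not vertices may occur as
  well, such as those with z_i = 0 and x_i = 1/2; this is harmless, since any finite generating set
  shows that the hull is a polytope.\<close>

lemma finite_lifted_cube_vertices: "finite (lifted_cube_vertices n)"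
  by (rule finite_subset[OF _ finite_euclid_values[of "{0, 1 / 2, 1}" "2 * n"]])
    (auto simp: lifted_cube_vertices_def lifted_cube_def)

text \<open>For z = e_j / 2 the coordinate x_j is forced to be 1/2 and the other x_i range freely
  over [0, 1], so the fibre is a cube. The induction is on a set \<open>K\<close> covering the
  indices whose coordinates may lie outside {0, 1/2, 1}, and it splits one coordinate at a
  time.\<close>

lemma lifted_cube_fibre_subset_hull:
  assumes "finite K" "j \<in> {1..n}" "x \<in> lifted_cube n"
    and "\<And>i. i \<in> {1..n} \<Longrightarrow> coord x (n + i) = (if i = j then 1 / 2 else 0)"
    and "\<And>i. i \<in> {1..n} - K \<Longrightarrow> coord x i \<in> {0, 1 / 2, 1}"
  shows "x \<in> convex hull (lifted_cube_vertices n)"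
  using assms
proof (induction K arbitrary: x)
  case empty
  have "coord x i \<in> {0, 1 / 2, 1}" if "i \<in> {1..2 * n}" for i
  proof (cases "i \<le> n")
    case True
    then show ?thesis
      using that empty.prems(4) by simp
  next
    case False
    then have "coord x (n + (i - n)) = (if i - n = j then 1 / 2 else 0)"
      using that by (intro empty.prems(3)) auto
    then show ?thesis
      using False by (auto split: if_splits)
  qed
  then show ?case
    using empty.prems(2) by (intro hull_inc) (simp add: lifted_cube_vertices_def)
next
  case (insert k K)
  have xE: "x \<in> euclid (2 * n)" and xS: "(\<Sum>i=1..n. coord x (n + i)) = 1 / 2"
    using insert.prems(2) by (simp_all add: lifted_cube_def)
  have xC: "0 \<le> coord x (n + i)" "coord x (n + i) \<le> coord x i" "coord x (n + i) \<le> 1 - coord x i"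
    if "i \<in> {1..n}" for i
    using insert.prems(2) that by (auto simp: lifted_cube_def)
  show ?case
  proof (cases "k \<in> {1..n} \<and> k \<noteq> j")
    \<comment> \<open>Here \<open>k\<close> calls for no splitting: either it lies outside
      \<open>{1..n}\<close>, or it is \<open>j\<close>, where z_j = 1/2 pins x_j to 1/2.\<close>
    case False
    have "coord x i \<in> {0, 1 / 2, 1}" if i: "i \<in> {1..n} - K" for i
    proof (cases "i = k")
      case True
      with False i have "i = j"
        by auto
      with insert.prems(1,3) xC[of j] have "coord x i = 1 / 2"
        by simp
      then show ?thesis
        by simp
    next
      case False
      with i show ?thesis
        by (intro insert.prems(4)) auto
    qed
    then show ?thesis
      using insert.IH[OF insert.prems(1,2,3)] by blast
  next
    case True
    \<comment> \<open>Moving coordinate \<open>k\<close> to 0 or 1 stays inside the lifted polytope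
      because z_k = 0.\<close>
    define y where "y t = mk_vec (2 * n) ((coord x)(k := t))" for t :: real
    have y: "coord (y t) i = (if i = k then t else coord x i)" if "i \<in> {1..2 * n}" for t i
      using that by (simp add: y_def)
    have y_hi: "coord (y t) (n + i) = coord x (n + i)" if "i \<in> {1..n}" for t i
      using that True by (simp add: y)
    have hull: "y t \<in> convex hull (lifted_cube_vertices n)" if t: "t \<in> {0, 1}" for t
    proof (rule insert.IH[OF insert.prems(1)])
      have "(\<Sum>i=1..n. coord (y t) (n + i)) = 1 / 2"
        using xS by (simp add: y_hi)
      moreover have "0 \<le> coord (y t) (n + i) \<and> coord (y t) (n + i) \<le> coord (y t) i \<and>
          coord (y t) (n + i) \<le> 1 - coord (y t) i" if i: "i \<in> {1..n}" for i
      proof (cases "i = k")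
        case True
        then show ?thesis
          using i t \<open>k \<in> {1..n} \<and> k \<noteq> j\<close> insert.prems(3)[of k] unfolding y_hi[OF i] by (auto simp: y)
      next
        case False
        then show ?thesis
          using i xC[OF i] unfolding y_hi[OF i] by (simp add: y)
      qed
      ultimately show "y t \<in> lifted_cube n"
        by (simp add: lifted_cube_def y_def)
      show "coord (y t) (n + i) = (if i = j then 1 / 2 else 0)" if "i \<in> {1..n}" for i
        using insert.prems(3)[OF that] y_hi[OF that] by simp
      show "coord (y t) i \<in> {0, 1 / 2, 1}" if "i \<in> {1..n} - K" for i
        using that t insert.prems(4)[of i] y[of i t] by (cases "i = k") auto
    qed
    \<comment> \<open>Only coordinate \<open>k\<close> varies, and x_k is itself the weight of
      \<open>y 1\<close>.\<close>
    have "x = (1 - coord x k) *\<^sub>R y 0 + coord x k *\<^sub>R y 1"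
    proof (rule euclid_eqI[OF xE])
      show "(1 - coord x k) *\<^sub>R y 0 + coord x k *\<^sub>R y 1 \<in> euclid (2 * n)"
        by (simp add: y_def subspace_add[OF subspace_euclid] subspace_scale[OF subspace_euclid])
      show "coord x i = coord ((1 - coord x k) *\<^sub>R y 0 + coord x k *\<^sub>R y 1) i" if "i \<in> {1..2 * n}" for i
        by (simp add: lookup_add y[OF that]) (simp add: left_diff_distrib)
    qed
    also have "\<dots> \<in> convex hull (lifted_cube_vertices n)"
      using xC[of k] True by (intro convexD[OF convex_convex_hull] hull) auto
    finally show ?thesis .
  qed
qed

text \<open>
  With weights \<open>2 z\<^sub>j\<close>, a point \<open>(x, z)\<close> is a convex combination of points whose second half is
  \<open>e\<^sub>j / 2\<close>: the first half of each has \<open>j\<close>-th coordinate \<open>1/2\<close> and the other coordinates are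
  \<open>(x\<^sub>i - z\<^sub>i) / (1 - 2 z\<^sub>i)\<close>. If \<open>1 - 2 z\<^sub>i = 0\<close> this quotient is \<open>0\<close>, which is harmless because
  its total weight is then \<open>0\<close>.
\<close>

lemma lifted_cube_subset_hull: "lifted_cube n \<subseteq> convex hull (lifted_cube_vertices n)"
proof
  fix x assume x: "x \<in> lifted_cube n"
  then have xE: "x \<in> euclid (2 * n)" and xS: "(\<Sum>i=1..n. coord x (n + i)) = 1 / 2"
    by (simp_all add: lifted_cube_def)
  have xC: "0 \<le> coord x (n + i)" "coord x (n + i) \<le> coord x i" "coord x (n + i) \<le> 1 - coord x i"
    if "i \<in> {1..n}" for i
    using x that by (auto simp: lifted_cube_def)
  define w where "w i = 2 * coord x (n + i)" for i
  have w_sum: "sum w {1..n} = 1"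
    using xS by (simp add: w_def flip: sum_distrib_left)
  have w_le: "0 \<le> w i" "w i \<le> 1" if "i \<in> {1..n}" for i
    using xC[OF that] by (simp_all add: w_def)
  define q where "q i = (coord x i - coord x (n + i)) / (1 - w i)" for i
  have q: "0 \<le> q i \<and> q i \<le> 1 \<and> w i / 2 + (1 - w i) * q i = coord x i" if "i \<in> {1..n}" for i
    using xC[OF that] by (cases "w i = 1") (auto simp: q_def w_def field_simps)
  define y where "y j = mk_vec (2 * n) (\<lambda>i. if i \<le> n then (if i = j then 1 / 2 else q i)
      else (if i = n + j then 1 / 2 else 0))" for j
  have y_lo: "coord (y j) i = (if i = j then 1 / 2 else q i)"
    and y_hi: "coord (y j) (n + i) = (if i = j then 1 / 2 else 0)" if "i \<in> {1..n}" for i j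
    using that by (simp_all add: y_def)
  have y_hull: "y j \<in> convex hull (lifted_cube_vertices n)" if j: "j \<in> {1..n}" for j
  \<comment> \<open>With all of \<open>{1..n}\<close> as \<open>K\<close>, the condition on
    coordinates outside \<open>K\<close> is vacuous.\<close>
  proof (rule lifted_cube_fibre_subset_hull[of "{1..n}" j])
    have "(\<Sum>i=1..n. coord (y j) (n + i)) = (\<Sum>i=1..n. if i = j then 1 / 2 else 0)"
      by (rule sum.cong) (simp_all add: y_hi)
    also have "\<dots> = 1 / 2"
      using j by (simp add: sum.delta)
    finally have "(\<Sum>i=1..n. coord (y j) (n + i)) = 1 / 2" .
    moreover have "0 \<le> coord (y j) (n + i) \<and> coord (y j) (n + i) \<le> coord (y j) i \<and>
          coord (y j) (n + i) \<le> 1 - coord (y j) i" if "i \<in> {1..n}" for i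
      using q[OF that] by (simp add: y_lo[OF that] y_hi[OF that])
    ultimately show "y j \<in> lifted_cube n"
      by (simp add: lifted_cube_def y_def)
  qed (use j y_hi in auto)
  have "x = (\<Sum>j=1..n. w j *\<^sub>R y j)"
  proof (rule euclid_eqI[OF xE])
    show "(\<Sum>j=1..n. w j *\<^sub>R y j) \<in> euclid (2 * n)"
      by (intro subspace_sum[OF subspace_euclid] subspace_scale[OF subspace_euclid]) (simp add: y_def)
    fix i assume i: "i \<in> {1..2 * n}"
    have eq: "coord (\<Sum>j=1..n. w j *\<^sub>R y j) i = (\<Sum>j=1..n. w j * coord (y j) i)"
      by (simp add: lookup_sum)
    show "coord x i = coord (\<Sum>j=1..n. w j *\<^sub>R y j) i"
    proof (cases "i \<le> n")
      case True
      with i have i': "i \<in> {1..n}"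
        by simp
      \<comment> \<open>Only \<open>y i\<close> has 1/2 at index \<open>i\<close>; the other points
        share the value \<open>q i\<close> and have total weight \<open>1 - w i\<close>.\<close>
      have "(\<Sum>j=1..n. w j * coord (y j) i)
          = w i * coord (y i) i + (\<Sum>j\<in>{1..n} - {i}. w j * coord (y j) i)"
        by (rule sum.remove) (use i' in auto)
      also have "(\<Sum>j\<in>{1..n} - {i}. w j * coord (y j) i) = (\<Sum>j\<in>{1..n} - {i}. w j * q i)"
        by (rule sum.cong) (auto simp: y_lo[OF i'])
      also have "\<dots> = (1 - w i) * q i"
        using w_sum i' by (simp add: sum_diff1 flip: sum_distrib_right)
      finally show ?thesis
        using q[OF i'] eq by (simp add: y_lo[OF i'])
    next
      case False
      then obtain k where k: "i = n + k" "k \<in> {1..n}"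
        using i by (intro that[of "i - n"]) auto
      have "(\<Sum>j=1..n. w j * coord (y j) i) = (\<Sum>j=1..n. if k = j then w j / 2 else 0)"
        by (rule sum.cong) (simp_all add: k(1) y_hi[OF k(2)])
      also have "\<dots> = coord x i"
        using k by (simp add: w_def)
      finally show ?thesis
        using eq by simp
    qed
  qed
  also have "\<dots> \<in> convex hull (lifted_cube_vertices n)"
    using w_sum w_le y_hull by (intro convex_sum) auto
  finally show "x \<in> convex hull (lifted_cube_vertices n)" .
qed

lemma polytope_lifted_cube: "polytope (lifted_cube n)"
proof -
  have "convex (lifted_cube n)"
    unfolding lifted_cube_eq_solutions by (rule lifted_cube.convex_solutions)
  then have "convex hull (lifted_cube_vertices n) \<subseteq> lifted_cube n"
    by (intro hull_minimal) (auto simp: lifted_cube_vertices_def)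
  then have "lifted_cube n = convex hull (lifted_cube_vertices n)"
    using lifted_cube_subset_hull by blast
  then show ?thesis
    using finite_lifted_cube_vertices polytope_def by blast
qed

section \<open>Projection onto the cropped cube\<close>

definition truncate_vec :: "nat \<Rightarrow> rvec \<Rightarrow> rvec" where
  "truncate_vec n x = mk_vec n (coord x)"

lemma linear_truncate_vec: "linear (truncate_vec n)"
  by (rule linearI; rule poly_mapping_eqI) (simp_all add: truncate_vec_def lookup_add)

text \<open>Given z, bounding z_i by x_i on \<open>I\<close> and by 1 - x_i off \<open>I\<close>
  yields each inequality of the cropped cube. Conversely, z is obtained from the minima of x_i and 1
  - x_i by scaling their sum down to 1/2.\<close>

lemma truncate_vec_lifted_cube: "truncate_vec n ` lifted_cube n = cropped_cube n"
proof
  show "truncate_vec n ` lifted_cube n \<subseteq> cropped_cube n"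
  proof
    fix y assume "y \<in> truncate_vec n ` lifted_cube n"
    then obtain x where x: "x \<in> lifted_cube n" and y: "y = truncate_vec n x"
      by blast
    have y_eq: "coord y i = coord x i" if "i \<in> {1..n}" for i
      using that by (simp add: y truncate_vec_def)
    have xS: "(\<Sum>i=1..n. coord x (n + i)) = 1 / 2"
      using x by (simp add: lifted_cube_def)
    have xC: "0 \<le> coord x (n + i)" "coord x (n + i) \<le> coord y i" "coord x (n + i) \<le> 1 - coord y i"
      if "i \<in> {1..n}" for i
      using x that by (auto simp: lifted_cube_def y_eq)
    have "1 / 2 \<le> (\<Sum>i\<in>I. coord y i) + (\<Sum>i\<in>{1..n} - I. 1 - coord y i)" if I: "I \<subseteq> {1..n}" for I
    proof -
      have "1 / 2 = (\<Sum>i\<in>I. coord x (n + i)) + (\<Sum>i\<in>{1..n} - I. coord x (n + i))"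
        using sum.subset_diff[OF I, of "\<lambda>i. coord x (n + i)"] xS by simp
      also have "\<dots> \<le> (\<Sum>i\<in>I. coord y i) + (\<Sum>i\<in>{1..n} - I. 1 - coord y i)"
        using I by (intro add_mono sum_mono xC) auto
      finally show ?thesis .
    qed
    moreover have "0 \<le> coord y i \<and> coord y i \<le> 1" if "i \<in> {1..n}" for i
      using xC[OF that] by linarith
    ultimately show "y \<in> cropped_cube n"
      by (simp add: cropped_cube_def y truncate_vec_def)
  qed
next
  show "cropped_cube n \<subseteq> truncate_vec n ` lifted_cube n"
  proof
    fix y assume y: "y \<in> cropped_cube n"
    define m where "m i = min (coord y i) (1 - coord y i)" for i
    define s where "s = sum m {1..n}"
    \<comment> \<open>This choice selects the smaller of x_i and 1 - x_i for every index, so its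
      inequality is the strongest one and reads \<open>s \<ge> 1/2\<close>.\<close>
    let ?I = "{i \<in> {1..n}. coord y i \<le> 1 / 2}"
    have "1 / 2 \<le> (\<Sum>i\<in>?I. coord y i) + (\<Sum>i\<in>{1..n} - ?I. 1 - coord y i)"
    proof -
      have "?I \<subseteq> {1..n}"
        by blast
      with y show ?thesis
        unfolding cropped_cube_def by blast
    qed
    also have "\<dots> = sum m ?I + sum m ({1..n} - ?I)"
      by (intro arg_cong2[of _ _ _ _ "(+)"] sum.cong) (auto simp: m_def min_def)
    also have "\<dots> = s"
      unfolding s_def by (subst add.commute, rule sum.subset_diff[symmetric]) auto
    finally have s: "1 / 2 \<le> s" .
    \<comment> \<open>The factor \<open>1 / (2 * s)\<close> makes z sum to 1/2; it is at most 1
      because \<open>s \<ge> 1/2\<close>, so the upper bounds on z survive.\<close>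
    define x where "x = mk_vec (2 * n) (\<lambda>i. if i \<le> n then coord y i else m (i - n) / (2 * s))"
    have x_lo: "coord x i = coord y i" and x_hi: "coord x (n + i) = m i / (2 * s)"
      if "i \<in> {1..n}" for i
      using that by (simp_all add: x_def)
    have "(\<Sum>i=1..n. coord x (n + i)) = (\<Sum>i=1..n. m i / (2 * s))"
      by (rule sum.cong) (simp_all add: x_hi)
    also have "\<dots> = s / (2 * s)"
      by (simp add: s_def sum_divide_distrib)
    finally have "(\<Sum>i=1..n. coord x (n + i)) = 1 / 2"
      using s by simp
    moreover have "0 \<le> coord x (n + i) \<and> coord x (n + i) \<le> coord x i \<and>
        coord x (n + i) \<le> 1 - coord x i" if i: "i \<in> {1..n}" for i
    proof -
      have "0 \<le> m i"
        using y i by (auto simp: cropped_cube_def m_def)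
      moreover have "m i / (2 * s) \<le> m i / 1"
        using s \<open>0 \<le> m i\<close> by (intro divide_left_mono) auto
      moreover have "m i \<le> coord y i" "m i \<le> 1 - coord y i"
        by (auto simp: m_def)
      ultimately show ?thesis
        using s by (simp add: x_lo[OF i] x_hi[OF i])
    qed
    ultimately have "x \<in> lifted_cube n"
      by (simp add: lifted_cube_def x_def)
    moreover have "y = truncate_vec n x"
      using y by (intro euclid_eqI[of _ n]) (auto simp: truncate_vec_def cropped_cube_def x_lo)
    ultimately show "y \<in> truncate_vec n ` lifted_cube n"
      by blast
  qed
qed

text \<open>On the first block the lift permutes and reflects exactly as \<open>g\<close> does, and
  truncation forgets the second block.\<close>

lemma truncate_vec_cube_lift:
  assumes "g \<in> carrier (cube_group n)" "x \<in> euclid (2 * n)"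
  shows "truncate_vec n (cube_lift n g x) = g (truncate_vec n x)"
proof -
  obtain \<pi> S where g: "g = signed_perm n \<pi> S" "\<pi> permutes {1..n}" "S \<subseteq> {1..n}"
    using assms(1) by (rule cube_group_elem)
  have t: "truncate_vec n x \<in> euclid n" for x
    by (simp add: truncate_vec_def)
  show ?thesis
    unfolding g(1) cube_lift_signed_perm[OF g(2,3)]
  proof (rule euclid_eqI[OF t signed_perm_in_euclid[OF t]])
    fix i assume i: "i \<in> {1..n}"
    then have pi: "\<pi> i \<in> {1..n}"
      by (simp only: permutes_in_image[OF g(2)])
    have "i \<in> {1..2 * n}"
      using i by simp
    then show "coord (truncate_vec n (signed_perm (2 * n) (double_perm n \<pi>) S x)) i =
        coord (signed_perm n \<pi> S (truncate_vec n x)) i"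
      unfolding coord_signed_perm[OF t i]
      using i pi by (simp add: truncate_vec_def coord_signed_perm[OF assms(2)] double_perm_def)
  qed
qed

section \<open>The symmetric extension and its size\<close>

lemma symmetric_extension_lifted_cube:
  "symmetric_extension (cube_group n) n (\<lambda>g. g) (cropped_cube n) (2 * n) (cube_lift n)
     (lifted_cube n) (truncate_vec n)"
proof -
  have E: "lifted_cube n \<subseteq> euclid (2 * n)"
    by (auto simp: lifted_cube_def)
  have eqv: "truncate_vec n (cube_lift n g x) = g (truncate_vec n x)"
    if "g \<in> carrier (cube_group n)" "x \<in> lifted_cube n" for g x
    using truncate_vec_cube_lift that E by blast
  \<comment> \<open>Invariance of the cropped cube is inherited from the lifted polytope through
    equivariance of the projection, without inspecting the inequalities.\<close>
  have inv: "g ` cropped_cube n = cropped_cube n" if g: "g \<in> carrier (cube_group n)" for g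
  proof -
    have "g ` cropped_cube n = (\<lambda>x. g (truncate_vec n x)) ` lifted_cube n"
      by (simp add: image_image flip: truncate_vec_lifted_cube)
    also have "\<dots> = (\<lambda>x. truncate_vec n (cube_lift n g x)) ` lifted_cube n"
      by (rule image_cong) (simp_all add: eqv[OF g])
    also have "\<dots> = truncate_vec n ` cube_lift n g ` lifted_cube n"
      by (simp add: image_image)
    also have "\<dots> = cropped_cube n"
      by (simp add: cube_lift_image_lifted_cube[OF g] truncate_vec_lifted_cube)
    finally show ?thesis .
  qed
  have "polytope (cropped_cube n)"
    using polytope_linear_image[OF linear_truncate_vec polytope_lifted_cube, of n n]
    by (simp add: truncate_vec_lifted_cube)
  moreover have "cropped_cube n \<subseteq> euclid n"
    by (auto simp: cropped_cube_def)
  moreover have "truncate_vec n ` euclid (2 * n) \<subseteq> euclid n"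
    by (auto simp: truncate_vec_def)
  ultimately show ?thesis
    unfolding symmetric_extension_def invariant_polytope_def
    using E eqv inv finite_cube_group affine_group_action_cube affine_group_action_cube_lift
      cube_lift_image_lifted_cube polytope_lifted_cube linear_truncate_vec truncate_vec_lifted_cube
    by simp
qed

theorem theorem4p1:
  shows "\<exists>size :: nat \<Rightarrow> nat.
           (\<lambda>n. real (size n)) \<in> O[at_top](\<lambda>n. real n) \<and>
           (\<forall>n\<ge>1. \<exists>d \<rho> Q p.
              symmetric_extension (cube_group n) n (\<lambda>g. g) (cropped_cube n) d \<rho> Q p \<and>
              extension_size Q = size n)"
\<comment> \<open>The witness is the exact facet number of the lifted polytope; its upper bound
  \<open>3 * n\<close> gives linear growth with constant 3.\<close>
proof (intro exI[of _ "\<lambda>n. extension_size (lifted_cube n)"] conjI allI impI)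
  have "real (extension_size (lifted_cube n)) \<le> 3 * real n" for n
    using extension_size_lifted_cube[of n] by linarith
  then show "(\<lambda>n. real (extension_size (lifted_cube n))) \<in> O[at_top](\<lambda>n. real n)"
    by (intro bigoI[of _ 3] always_eventually) simp
next
  fix n :: nat
  show "\<exists>d \<rho> Q p. symmetric_extension (cube_group n) n (\<lambda>g. g) (cropped_cube n) d \<rho> Q p \<and>
          extension_size Q = extension_size (lifted_cube n)"
    using symmetric_extension_lifted_cube by blast
qed

end
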